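(* Let $n \in \mathbb{N}$. For every $x \in [0,1)$, $$\int_0^1 \left| \sum_{k=0}^{n-1} \mathrm{wal}_k(x)\,\mathrm{wal}_k(u) \right| \mathrm{d}u \;=\; n\, D_n^{*}(Y^{\mathrm{vdC}}).$$ That is, the $n$-th Lebesgue constant $L_n$ of the Walsh system equals the non-normalized star discrepancy $d_n := n D_n^*(Y^{\mathrm{vdC}})$ of the first $n$ terms of the van der Corput sequence.
   Context: Walsh functions: for a nonnegative integer $k$ with binary representation $k=k_0+k_1 2+\cdots+k_m 2^m$, the function $\mathrm{wal}_k:\mathbb{R}\to\mathbb{R}$ is $1$-periodic and defined for $x\in[0,1)$ with canonical binary expansion $x=\frac{x_1}{2}+\frac{x_2}{2^2}+\cdots$ (not ending in infinitely many $1$'s) by $\mathrm{wal}_k(x)=(-1)^{x_1k_0+x_2k_1+\cdots+x_{m+1}k_m}$. The Lebesgue function of the Walsh system is $L_n(x):=\int_0^1|\sum_{k=0}^{n-1}\mathrm{wal}_k(x)\mathrm{wal}_k(u)|\,\mathrm{d}u$; it is independent of $x$ and its common value is the Lebesgue constant $L_n$. Van der Corput sequence $Y^{\mathrm{vdC}}=(y_k)_{k\ge0}$: if $k=k_0+k_1 2+k_2 2^2+\cdots$ in binary, then $y_k=\frac{k_0}{2}+\frac{k_1}{2^2}+\frac{k_2}{2^3}+\cdots$. For a sequence $X=(x_k)_{k\ge0}$ in $[0,1)$, the star discrepancy of its first $n$ terms is $D_n^*(X)=\sup_{t\in[0,1]}\left|\frac{\#\{0\le k<n: x_k\in[0,t)\}}{n}-t\right|$.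 *)

theory Defs
  imports "HOL-Analysis.Analysis"
begin

text \<open>Position \<open>i\<close> of \<open>d\<close> holds the digit with weight \<open>1 / 2 ^ (i + 1)\<close>, i.e. the digit
  usually written \<open>x\<^sub>i\<^sub>+\<^sub>1\<close>.\<close>

definition canonical_binary_expansion :: "real \<Rightarrow> (nat \<Rightarrow> nat) \<Rightarrow> bool" where
  "canonical_binary_expansion x d \<longleftrightarrow>
     (\<forall>i. d i \<in> {0, 1}) \<and> (\<exists>\<^sub>\<infinity>i. d i \<noteq> 1) \<and> (\<lambda>i. real (d i) / 2 ^ (i + 1)) sums x"

definition binary_digit :: "real \<Rightarrow> nat \<Rightarrow> nat" where
  "binary_digit x = (THE d. canonical_binary_expansion x d)"

definition nat_digit :: "nat \<Rightarrow> nat \<Rightarrow> nat" where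
  "nat_digit k i = k div 2 ^ i mod 2"

text \<open>Since \<open>k < 2 ^ k\<close>, all binary digits of \<open>k\<close> at positions \<open>j \<ge> k\<close> vanish, so the finite
  sums over \<open>j < k\<close> below run over all nonzero digits.\<close>

definition wal :: "nat \<Rightarrow> real \<Rightarrow> real" where
  "wal k x = (-1) ^ (\<Sum>j<k. binary_digit (frac x) j * nat_digit k j)"

definition van_der_corput :: "nat \<Rightarrow> real" where
  "van_der_corput k = (\<Sum>j<k. real (nat_digit k j) / 2 ^ (j + 1))"

definition star_discrepancy :: "(nat \<Rightarrow> real) \<Rightarrow> nat \<Rightarrow> real" where
  "star_discrepancy X n =
     (SUP t\<in>{0..1}. \<bar>real (card {k. k < n \<and> X k \<in> {0..<t}}) / real n - t\<bar>)"

definition walsh_lebesgue_function :: "nat \<Rightarrow> real \<Rightarrow> real" where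
  "walsh_lebesgue_function n x = (LINT u:{0..1}|lborel. \<bar>\<Sum>k<n. wal k x * wal k u\<bar>)"

definition walsh_lebesgue_constant :: "nat \<Rightarrow> real" where
  "walsh_lebesgue_constant n =
     (THE L. \<forall>x\<in>{0..<1}. walsh_lebesgue_function n x = L)"


text \<open>The description in \<^term>\<open>binary_digit\<close> is well defined on \<open>[0, 1)\<close>, and the digits are
  given by the usual floor formula.\<close>

lemma nat_digit_eq_0: "nat_digit k j = 0" if "k \<le> j"
proof -
  have "k < 2 ^ k" by (rule less_exp)
  also have "(2::nat) ^ k \<le> 2 ^ j" using that by (intro power_increasing) auto
  finally show ?thesis by (simp add: nat_digit_def)
qed

lemma canonical_binary_expansion_range:
  assumes "canonical_binary_expansion x d"
  shows "0 \<le> x" "x < 1"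
proof -
  have d: "d i = 0 \<or> d i = 1" for i
    using assms by (auto simp: canonical_binary_expansion_def)
  have s: "(\<lambda>i. real (d i) / 2 ^ (i + 1)) sums x"
    using assms by (simp add: canonical_binary_expansion_def)
  show "0 \<le> x"
    by (rule sums_le[OF _ sums_zero s]) auto
  obtain m where m: "d m \<noteq> 1"
    using assms unfolding canonical_binary_expansion_def by (meson INFM_EX)
  have "(\<lambda>i. (1/2 :: real) ^ Suc i - real (d i) / 2 ^ (i + 1)) sums (1 - x)"
    by (intro sums_diff power_half_series s)
  then have t: "(\<lambda>i. (1 - real (d i)) / 2 ^ (i + 1)) sums (1 - x)"
    by (simp add: power_divide diff_divide_distrib)
  have nn: "0 \<le> (1 - real (d i)) / 2 ^ (i + 1)" for i
    using d[of i] by auto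
  have pos: "0 < (1 - real (d m)) / 2 ^ (m + 1)"
    using d[of m] m by auto
  have "0 < suminf (\<lambda>i. (1 - real (d i)) / 2 ^ (i + 1))"
    using suminf_pos2[OF sums_summable[OF t] nn pos] .
  then show "x < 1" using sums_unique[OF t] by simp
qed

lemma canonical_binary_expansion_shift:
  assumes "canonical_binary_expansion x d"
  shows "canonical_binary_expansion (2 * x - real (d 0)) (\<lambda>i. d (Suc i))"
proof -
  have s: "(\<lambda>i. real (d i) / 2 ^ (i + 1)) sums x"
    using assms by (simp add: canonical_binary_expansion_def)
  have "(\<lambda>i. real (d (Suc i)) / 2 ^ (Suc i + 1)) sums (x - real (d 0) / 2)"
    using s by (subst sums_Suc_iff) simp
  from sums_mult[OF this, of 2]
  have "(\<lambda>i. real (d (Suc i)) / 2 ^ (i + 1)) sums (2 * x - real (d 0))"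
    by (simp add: algebra_simps)
  moreover have "\<exists>\<^sub>\<infinity>i. d (Suc i) \<noteq> 1"
  proof (rule ccontr)
    assume "\<not> ?thesis"
    then obtain m where "\<And>i. i \<ge> m \<Longrightarrow> d (Suc i) = 1"
      by (auto simp: not_INFM MOST_nat_le)
    then have "\<And>i. i \<ge> Suc m \<Longrightarrow> d i = 1"
      by (metis Suc_le_D Suc_le_mono)
    then have "\<forall>\<^sub>\<infinity>i. d i = 1"
      unfolding MOST_nat_le by blast
    then show False
      using assms by (simp add: canonical_binary_expansion_def frequently_def)
  qed
  ultimately show ?thesis
    using assms by (simp add: canonical_binary_expansion_def)
qed

lemma canonical_binary_expansion_unique:
  assumes "canonical_binary_expansion x d"
  shows "d i = nat (\<lfloor>2 ^ (i + 1) * x\<rfloor> mod 2)"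
  using assms
proof (induction i arbitrary: x d)
  case 0
  have "\<lfloor>2 * x - real (d 0)\<rfloor> = 0"
    using canonical_binary_expansion_range[OF canonical_binary_expansion_shift[OF 0]]
    by (simp add: floor_eq_iff)
  then have "\<lfloor>2 * x\<rfloor> = int (d 0)"
    by linarith
  moreover have "d 0 = 0 \<or> d 0 = 1"
    using 0 by (auto simp: canonical_binary_expansion_def)
  ultimately show ?case by auto
next
  case (Suc i)
  have "d (Suc i) = nat (\<lfloor>2 ^ (i + 1) * (2 * x - real (d 0))\<rfloor> mod 2)"
    using Suc.IH[OF canonical_binary_expansion_shift[OF Suc.prems]] .
  also have "2 ^ (i + 1) * (2 * x - real (d 0))
      = 2 ^ (Suc i + 1) * x - of_int (2 ^ (i + 1) * int (d 0))"
    by (simp add: algebra_simps)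
  also have "\<lfloor>\<dots>\<rfloor> = \<lfloor>2 ^ (Suc i + 1) * x\<rfloor> - 2 * (2 ^ i * int (d 0))"
    unfolding floor_diff_of_int by simp
  also have "\<dots> mod 2 = \<lfloor>2 ^ (Suc i + 1) * x\<rfloor> mod 2"
    by presburger
  finally show ?case .
qed

lemma canonical_binary_expansion_exists:
  assumes "0 \<le> x" "x < 1"
  shows "canonical_binary_expansion x (\<lambda>i. nat (\<lfloor>2 ^ (i + 1) * x\<rfloor> mod 2))"
proof -
  define d where "d = (\<lambda>i. nat (\<lfloor>2 ^ (i + 1) * x\<rfloor> mod 2))"
  have d01: "d i \<in> {0, 1}" for i
    unfolding d_def by (auto simp: mod_2_eq_odd)
  have step: "\<lfloor>2 ^ Suc i * x\<rfloor> = 2 * \<lfloor>2 ^ i * x\<rfloor> + int (d i)" for i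
  proof -
    have "\<lfloor>2 ^ Suc i * x\<rfloor> div 2 = \<lfloor>2 ^ i * x\<rfloor>"
      using floor_divide_real_eq_div[of 2 "2 ^ Suc i * x"] by simp
    moreover have "int (d i) = \<lfloor>2 ^ Suc i * x\<rfloor> mod 2"
      by (simp add: d_def)
    ultimately show ?thesis by presburger
  qed
  have partial: "(\<Sum>i<N. real (d i) / 2 ^ (i + 1)) = of_int \<lfloor>2 ^ N * x\<rfloor> / 2 ^ N" for N
  proof (induction N)
    case 0
    then show ?case using assms by (simp add: floor_eq_iff)
  next
    case (Suc N)
    then show ?case unfolding step by (simp add: field_simps)
  qed
  have bnd: "x - (1/2) ^ N < of_int \<lfloor>2 ^ N * x\<rfloor> / 2 ^ N \<and> of_int \<lfloor>2 ^ N * x\<rfloor> / 2 ^ N \<le> x" for N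
  proof -
    have "2 ^ N * x - 1 < of_int \<lfloor>2 ^ N * x\<rfloor>" "of_int \<lfloor>2 ^ N * x\<rfloor> \<le> 2 ^ N * x"
      by linarith+
    then show ?thesis by (simp add: divide_simps power_one_over) (simp add: mult.commute add.commute)
  qed
  have "(\<lambda>N. of_int \<lfloor>2 ^ N * x\<rfloor> / 2 ^ N) \<longlonglongrightarrow> x"
  proof (rule tendsto_sandwich[OF _ _ _ tendsto_const])
    show "(\<lambda>N. x - (1/2) ^ N) \<longlonglongrightarrow> x"
      by (auto intro!: tendsto_eq_intros LIMSEQ_power_zero)
  qed (use bnd in \<open>auto intro: less_imp_le always_eventually\<close>)
  then have s: "(\<lambda>i. real (d i) / 2 ^ (i + 1)) sums x"
    unfolding sums_def partial .
  have "\<exists>\<^sub>\<infinity>i. d i \<noteq> 1"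
  proof (rule ccontr)
    assume "\<not> ?thesis"
    then obtain N where N: "\<And>i. i \<ge> N \<Longrightarrow> d i = 1"
      by (auto simp: not_INFM MOST_nat_le)
    have "(\<lambda>i. (1/2) ^ N * (1/2 :: real) ^ Suc i) sums ((1/2) ^ N * 1)"
      by (intro sums_mult power_half_series)
    then have "(\<lambda>i. real (d (i + N)) / 2 ^ (i + N + 1)) sums ((1/2) ^ N)"
      using N by (simp add: power_add power_divide mult_ac)
    moreover have "(\<lambda>i. real (d (i + N)) / 2 ^ (i + N + 1)) sums
        (x - of_int \<lfloor>2 ^ N * x\<rfloor> / 2 ^ N)"
      using s by (subst sums_iff_shift) (simp only: partial[symmetric], simp)
    ultimately show False
      using bnd[of N] sums_unique2 by fastforce
  qed
  then show ?thesis
    using d01 s unfolding canonical_binary_expansion_def d_def by blast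
qed

lemma canonical_binary_expansion_binary_digit:
  assumes "0 \<le> x" "x < 1"
  shows "canonical_binary_expansion x (binary_digit x)"
  unfolding binary_digit_def
proof (rule theI'[of "canonical_binary_expansion x"])
  show "\<exists>!d. canonical_binary_expansion x d"
  proof (rule ex1I)
    show "canonical_binary_expansion x (\<lambda>i. nat (\<lfloor>2 ^ (i + 1) * x\<rfloor> mod 2))"
      by (rule canonical_binary_expansion_exists[OF assms])
    show "d = (\<lambda>i. nat (\<lfloor>2 ^ (i + 1) * x\<rfloor> mod 2))"
      if "canonical_binary_expansion x d" for d
      using canonical_binary_expansion_unique[OF that] by blast
  qed
qed

lemma binary_digit_eq:
  assumes "0 \<le> x" "x < 1"
  shows "binary_digit x i = nat (\<lfloor>2 ^ (i + 1) * x\<rfloor> mod 2)"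
  by (rule canonical_binary_expansion_unique[OF canonical_binary_expansion_binary_digit[OF assms]])

end

theory Submission
  imports Defs
begin

text \<open>Both sides satisfy the recursion \<open>L\<^sub>0 = 0\<close>, \<open>L\<^sub>1 = 1\<close>, \<open>L\<^sub>2\<^sub>n = L\<^sub>n\<close>,
  \<open>2 L\<^sub>2\<^sub>n\<^sub>+\<^sub>1 = 1 + L\<^sub>n + L\<^sub>n\<^sub>+\<^sub>1\<close>. For the Walsh kernel \<open>K\<^sub>n\<close>, splitting off the first binary
  digits of \<open>x\<close> and \<open>u\<close> gives \<open>K\<^sub>2\<^sub>n\<^sub>+\<^sub>1(x, u) = (K\<^sub>n + K\<^sub>n\<^sub>+\<^sub>1)(2x, 2u)\<close> if these digits agree and
  \<open>\<plusminus>1\<close> otherwise; as \<open>K\<^sub>n\<close> and \<open>K\<^sub>n\<^sub>+\<^sub>1\<close> are integers at distance 1, they never have opposite signs.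
  For the van der Corput sequence the local discrepancy is nonnegative and obeys an analogous
  recursion, whose upper bound is sharp because the discrepancies of \<open>n\<close> and \<open>n + 1\<close> points
  almost attain their suprema at a common \<open>t\<close>.\<close>

text \<open>The value at 1 has to be a base case: the odd rule at 1 would call itself at
  \<open>Suc (1 div 2)\<close>.\<close>

function lebesgue_rec :: "nat \<Rightarrow> real" where
  "lebesgue_rec n =
     (if n \<le> 1 then real n
      else if even n then lebesgue_rec (n div 2)
      else (1 + lebesgue_rec (n div 2) + lebesgue_rec (Suc (n div 2))) / 2)"
  by auto
termination
  by (relation "Wellfounded.measure id") (auto elim!: oddE)

declare lebesgue_rec.simps [simp del]

lemma lebesgue_rec_0 [simp]: "lebesgue_rec 0 = 0"
  and lebesgue_rec_1 [simp]: "lebesgue_rec (Suc 0) = 1"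
  by (simp_all add: lebesgue_rec.simps)

lemma lebesgue_rec_double [simp]: "lebesgue_rec (2 * n) = lebesgue_rec n"
  by (cases "n = 0") (simp_all add: lebesgue_rec.simps[of "2 * n"])

lemma lebesgue_rec_double_Suc:
  "lebesgue_rec (Suc (2 * n)) = (1 + lebesgue_rec n + lebesgue_rec (Suc n)) / 2"
  by (cases "n = 0") (simp_all add: lebesgue_rec.simps[of "Suc (2 * n)"])

lemma nat_digit_simps [simp]:
  "nat_digit 0 j = 0"
  "nat_digit (Suc 0) 0 = 1" "nat_digit (2 * k) 0 = 0" "nat_digit (Suc (2 * k)) 0 = 1"
  "nat_digit (2 * k) (Suc j) = nat_digit k j" "nat_digit (Suc (2 * k)) (Suc j) = nat_digit k j"
  by (simp_all add: nat_digit_def div_mult2_eq)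

text \<open>\<open>wal\<close> and \<open>van_der_corput\<close> cut their sums at the index itself;
  comparing the indices \<open>k\<close> and \<open>2 * k\<close> takes a common range.\<close>

lemma sum_nat_digit_cutoff:
  fixes f :: "nat \<Rightarrow> nat \<Rightarrow> 'a::comm_monoid_add"
  assumes "\<And>j. f j 0 = 0" "k \<le> N"
  shows "(\<Sum>j<k. f j (nat_digit k j)) = (\<Sum>j<N. f j (nat_digit k j))"
  using assms by (intro sum.mono_neutral_left) (auto simp: nat_digit_eq_0)


section \<open>Walsh functions\<close>

text \<open>Dropping the integer part of \<open>x\<close> changes \<open>2 ^ (i + 1) * x\<close> by
  an even integer, so the floor formula extends to every real \<open>x\<close>.\<close>

lemma binary_digit_frac: "binary_digit (frac x) i = nat (\<lfloor>2 ^ (i + 1) * x\<rfloor> mod 2)"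
proof -
  have "2 ^ (i + 1) * frac x = 2 ^ (i + 1) * x - of_int (2 * (2 ^ i * \<lfloor>x\<rfloor>))"
    by (simp add: frac_def algebra_simps)
  then have "\<lfloor>2 ^ (i + 1) * frac x\<rfloor> = \<lfloor>2 ^ (i + 1) * x\<rfloor> - 2 * (2 ^ i * \<lfloor>x\<rfloor>)"
    by (simp only: floor_diff_of_int)
  then have "\<lfloor>2 ^ (i + 1) * frac x\<rfloor> mod 2 = \<lfloor>2 ^ (i + 1) * x\<rfloor> mod 2"
    by presburger
  then show ?thesis
    by (simp add: binary_digit_eq frac_lt_1)
qed

lemma binary_digit_frac_Suc: "binary_digit (frac x) (Suc i) = binary_digit (frac (2 * x)) i"
  by (simp add: binary_digit_frac mult_ac)

lemma wal_cutoff: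
  assumes "k \<le> N"
  shows "wal k x = (-1) ^ (\<Sum>j<N. binary_digit (frac x) j * nat_digit k j)"
  using sum_nat_digit_cutoff[of "\<lambda>j d. binary_digit (frac x) j * d", OF _ assms]
  by (simp add: wal_def)

lemma wal_0 [simp]: "wal 0 x = 1"
  by (simp add: wal_def)

text \<open>Digit 0 of \<open>2 * k\<close> vanishes and the others meet the shifted digits of
  \<open>x\<close>, which are those of \<open>2 * x\<close>. The ranges \<open>Suc (2 * k)\<close>
  and \<open>2 * k\<close> agree once position 0 is split off.\<close>

lemma wal_double: "wal (2 * k) x = wal k (2 * x)"
  using wal_cutoff[of "2 * k" "Suc (2 * k)" x] wal_cutoff[of k "2 * k" "2 * x"]
  by (simp add: sum.lessThan_Suc_shift binary_digit_frac_Suc del: sum.lessThan_Suc)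

lemma wal_double_Suc: "wal (Suc (2 * k)) x = wal 1 x * wal k (2 * x)"
  using wal_cutoff[of "Suc (2 * k)" "Suc (2 * k)" x] wal_cutoff[of k "2 * k" "2 * x"]
  by (simp add: wal_def[of "Suc 0"] sum.lessThan_Suc_shift binary_digit_frac_Suc power_add
      del: sum.lessThan_Suc)

lemma wal_cases: "wal k x = 1 \<or> wal k x = -1"
  unfolding wal_def by (metis minus_one_power_iff)

lemma wal_1: "wal 1 x = (if even \<lfloor>2 * x\<rfloor> then 1 else -1)"
  by (auto simp: wal_def binary_digit_frac mod_2_eq_odd)

lemma wal_plus_1 [simp]: "wal k (x + 1) = wal k x"
  by (simp add: wal_def frac_1_eq)

lemma borel_measurable_wal [measurable]: "wal k \<in> borel_measurable borel"
proof (induction k rule: nat_bit_induct)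
  case zero
  have "wal 0 = (\<lambda>_. 1)" by auto
  then show ?case by simp
next
  case (even k)
  have [measurable]: "wal k \<in> borel_measurable borel" by fact
  have "wal (2 * k) = (\<lambda>x. wal k (2 * x))"
    by (simp add: wal_double fun_eq_iff)
  then show ?case by simp
next
  case (odd k)
  have [measurable]: "wal k \<in> borel_measurable borel" by fact
  have "wal (Suc (2 * k)) = (\<lambda>x. (if even \<lfloor>2 * x\<rfloor> then 1 else -1) * wal k (2 * x))"
    by (simp only: wal_double_Suc wal_1 fun_eq_iff) simp
  also have "\<dots> \<in> borel_measurable borel"
    by measurable
  finally show ?case .
qed

section \<open>The Dirichlet kernel of the Walsh system\<close>

definition walsh_kernel :: "nat \<Rightarrow> real \<Rightarrow> real \<Rightarrow> real" where
  "walsh_kernel n x u = (\<Sum>k<n. wal k x * wal k u)"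

lemma walsh_kernel_0 [simp]: "walsh_kernel 0 x u = 0"
  and walsh_kernel_Suc: "walsh_kernel (Suc n) x u = walsh_kernel n x u + wal n x * wal n u"
  by (simp_all add: walsh_kernel_def)

lemma walsh_kernel_plus_1 [simp]: "walsh_kernel n x (u + 1) = walsh_kernel n x u"
  by (simp add: walsh_kernel_def)

text \<open>The terms of index \<open>2 * k\<close> and \<open>Suc (2 * k)\<close> share the factor
  \<open>wal k (2 * x) * wal k (2 * u)\<close> and are summed as a pair.\<close>

lemma walsh_kernel_double:
  "walsh_kernel (2 * n) x u = (1 + wal 1 x * wal 1 u) * walsh_kernel n (2 * x) (2 * u)"
proof (induction n)
  case (Suc n)
  have "walsh_kernel (2 * Suc n) x u
      = walsh_kernel (2 * n) x u + wal (2 * n) x * wal (2 * n) u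
        + wal (Suc (2 * n)) x * wal (Suc (2 * n)) u"
    by (simp add: walsh_kernel_Suc)
  then show ?case
    unfolding Suc.IH wal_double wal_double_Suc walsh_kernel_Suc by (simp add: algebra_simps)
qed simp

lemma walsh_kernel_double_Suc:
  "walsh_kernel (Suc (2 * n)) x u =
     (1 + wal 1 x * wal 1 u) * walsh_kernel n (2 * x) (2 * u) + wal n (2 * x) * wal n (2 * u)"
  by (simp add: walsh_kernel_Suc walsh_kernel_double wal_double)

lemma walsh_kernel_Ints: "walsh_kernel n x u \<in> \<int>"
  unfolding walsh_kernel_def
  by (intro Ints_sum Ints_mult) (use wal_cases in \<open>metis Ints_1 Ints_minus\<close>)+

lemma abs_walsh_kernel_double:
  "\<bar>walsh_kernel (2 * n) x u\<bar> =
     (if wal 1 u = wal 1 x then 2 * \<bar>walsh_kernel n (2 * x) (2 * u)\<bar> else 0)"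
  using wal_cases[of 1 x] wal_cases[of 1 u]
  by (auto simp: walsh_kernel_double abs_mult simp del: One_nat_def)

lemma abs_walsh_kernel_double_Suc:
  "\<bar>walsh_kernel (Suc (2 * n)) x u\<bar> =
     (if wal 1 u = wal 1 x
      then \<bar>walsh_kernel n (2 * x) (2 * u)\<bar> + \<bar>walsh_kernel (Suc n) (2 * x) (2 * u)\<bar> else 1)"
proof -
  obtain z where z: "walsh_kernel n (2 * x) (2 * u) = of_int z"
    using walsh_kernel_Ints by (metis Ints_cases)
  have w: "wal n (2 * x) * wal n (2 * u) = 1 \<or> wal n (2 * x) * wal n (2 * u) = -1"
    using wal_cases[of n "2 * x"] wal_cases[of n "2 * u"] by auto
  \<comment> \<open>Integrality enters here: no integer lies strictly between -1 and 0, so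
    \<open>z\<close> and \<open>z + 1\<close> never have opposite signs; likewise \<open>z\<close>
    and \<open>z - 1\<close> below.\<close>
  have "\<bar>2 * real_of_int z + 1\<bar> = \<bar>of_int z\<bar> + \<bar>of_int z + 1\<bar>"
    by (cases "z \<ge> 0") linarith+
  moreover have "\<bar>2 * real_of_int z - 1\<bar> = \<bar>of_int z\<bar> + \<bar>of_int z - 1\<bar>"
    by (cases "z > 0") linarith+
  ultimately show ?thesis
    unfolding walsh_kernel_double_Suc walsh_kernel_Suc[of n "2 * x"] z
    using wal_cases[of 1 x] wal_cases[of 1 u] w by (auto simp del: One_nat_def)
qed

section \<open>Integration over the two halves of the unit interval\<close>

lemma has_integral_halves:
  fixes f g h :: "real \<Rightarrow> real"
  assumes g: "(g has_integral I) {0..1}" and h: "(h has_integral J) {0..1}"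
    and fg: "\<And>u. 0 \<le> u \<Longrightarrow> u < 1 \<Longrightarrow> f (u / 2) = g u"
    and fh: "\<And>u. 0 \<le> u \<Longrightarrow> u < 1 \<Longrightarrow> f ((u + 1) / 2) = h u"
  shows "(f has_integral (I + J) / 2) {0..1}"
proof -
  have A: "((\<lambda>x. k (2 * x + c)) has_integral K / 2) {- c / 2..(1 - c) / 2}"
    if "(k has_integral K) {0..1}" for k :: "real \<Rightarrow> real" and K c
    using has_integral_affinity[of k K 0 1 2 c] that
    by (simp add: image_affinity_atLeastAtMost_div_diff diff_divide_distrib)
  have "((\<lambda>x. g (2 * x)) has_integral I / 2) {0..1/2}"
    using A[OF g, of 0] by simp
  then have "(f has_integral I / 2) {0..1/2}"
  \<comment> \<open>At \<open>1/2\<close> the function \<open>f\<close> follows \<open>h\<close>, so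
    this point is excepted.\<close>
  proof (rule has_integral_spike_finite[of "{1/2}", rotated 2])
    show "f x = g (2 * x)" if "x \<in> {0..1/2} - {1/2}" for x
      using fg[of "2 * x"] that by simp
  qed simp
  moreover have "((\<lambda>x. h (2 * x + - 1)) has_integral J / 2) {1/2..1}"
    using A[OF h, of "-1"] by simp
  then have "(f has_integral J / 2) {1/2..1}"
  proof (rule has_integral_spike_finite[of "{1}", rotated 2])
    show "f x = h (2 * x + - 1)" if "x \<in> {1/2..1} - {1}" for x
      using fh[of "2 * x - 1"] that by simp
  qed simp
  ultimately have "(f has_integral I / 2 + J / 2) {0..1}"
    by (intro has_integral_combine[of 0 "1/2" 1]) auto
  then show ?thesis by (simp add: add_divide_distrib)
qed

text \<open>Which half of the interval carries \<open>g\<close> depends on \<open>x\<close>, but the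
  integral does not; this is why the Lebesgue function is constant. Periodicity of \<open>g\<close>
  covers the case of the right half.\<close>

lemma has_integral_first_digit:
  fixes f g :: "real \<Rightarrow> real"
  assumes g: "(g has_integral I) {0..1}"
    and per: "\<And>u. g (u + 1) = g u"
    and f: "\<And>u. f u = (if wal 1 u = wal 1 x then g (2 * u) else c)"
  shows "(f has_integral (I + c) / 2) {0..1}"
proof -
  have c: "((\<lambda>_. c) has_integral c) {0..1::real}"
    using has_integral_const_real[of c 0 1] by simp
  have lo: "wal 1 (u / 2) = 1" and hi: "wal 1 ((u + 1) / 2) = -1" if "0 \<le> u" "u < 1" for u
  proof -
    have "\<lfloor>2 * (u / 2)\<rfloor> = 0" "\<lfloor>2 * ((u + 1) / 2)\<rfloor> = 1"
      using that by (simp_all add: floor_eq_iff)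
    then show "wal 1 (u / 2) = 1" "wal 1 ((u + 1) / 2) = -1"
      unfolding wal_1 by simp_all
  qed
  have f_hi: "f ((u + 1) / 2) = (if wal 1 ((u + 1) / 2) = wal 1 x then g u else c)" for u
  proof -
    have "2 * ((u + 1) / 2) = u + 1" by simp
    then show ?thesis by (simp only: f per)
  qed
  consider "wal 1 x = 1" | "wal 1 x = -1"
    using wal_cases by blast
  then show ?thesis
  proof cases
    case 1
    show ?thesis
      by (rule has_integral_halves[OF g c]) (simp_all only: f_hi lo hi, simp_all add: f lo 1 del: One_nat_def)
  next
    case 2
    have "(f has_integral (c + I) / 2) {0..1}"
      by (rule has_integral_halves[OF c g]) (simp_all only: f_hi lo hi, simp_all add: f lo 2 per del: One_nat_def)
    then show ?thesis by (simp add: add.commute)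
  qed
qed

lemma has_integral_abs_walsh_kernel:
  "((\<lambda>u. \<bar>walsh_kernel n x u\<bar>) has_integral lebesgue_rec n) {0..1}"
proof -
  have double: "((\<lambda>u. \<bar>walsh_kernel (2 * n) x u\<bar>) has_integral lebesgue_rec (2 * n)) {0..1}"
    if "\<And>x. ((\<lambda>u. \<bar>walsh_kernel n x u\<bar>) has_integral lebesgue_rec n) {0..1}" for n x
    using has_integral_first_digit[OF has_integral_mult_right[OF that[of "2 * x"], of 2] _
        abs_walsh_kernel_double[of n x]] by simp
  have double_Suc:
    "((\<lambda>u. \<bar>walsh_kernel (Suc (2 * n)) x u\<bar>) has_integral lebesgue_rec (Suc (2 * n))) {0..1}"
    if "\<And>x. ((\<lambda>u. \<bar>walsh_kernel n x u\<bar>) has_integral lebesgue_rec n) {0..1}"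
      "\<And>x. ((\<lambda>u. \<bar>walsh_kernel (Suc n) x u\<bar>) has_integral lebesgue_rec (Suc n)) {0..1}" for n x
    using has_integral_first_digit[OF has_integral_add[OF that(1)[of "2 * x"] that(2)[of "2 * x"]] _
        abs_walsh_kernel_double_Suc[of n x]]
    by (simp add: lebesgue_rec_double_Suc add_ac)
  \<comment> \<open>The odd rule uses \<open>n\<close> and \<open>Suc n\<close>, so the induction
    runs over consecutive pairs; it keeps \<open>x\<close> general because the kernels are evaluated
    at \<open>2 * x\<close>.\<close>
  have "\<forall>x. ((\<lambda>u. \<bar>walsh_kernel n x u\<bar>) has_integral lebesgue_rec n) {0..1} \<and>
      ((\<lambda>u. \<bar>walsh_kernel (Suc n) x u\<bar>) has_integral lebesgue_rec (Suc n)) {0..1}"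
  proof (induction n rule: nat_bit_induct)
    case zero
    show ?case
      using has_integral_const_real[of "1::real" 0 1] by (simp add: walsh_kernel_Suc)
  next
    case (even n)
    then show ?case
      by (intro allI conjI double double_Suc) blast+
  next
    case (odd n)
    then show ?case
      using double[of "Suc n"] double_Suc[of n] by simp
  qed
  then show ?thesis by blast
qed

text \<open>The kernel is measurable and bounded, so its Lebesgue integral equals the gauge integral
  computed above.\<close>

lemma walsh_lebesgue_function_eq: "walsh_lebesgue_function n x = lebesgue_rec n"
proof -
  have meas: "(\<lambda>u. \<bar>walsh_kernel n x u\<bar>) \<in> borel_measurable borel"
    unfolding walsh_kernel_def by measurable
  have "\<bar>wal k x * wal k u\<bar> = 1" for k u
    using wal_cases[of k x] wal_cases[of k u] by auto
  then have bound: "\<bar>walsh_kernel n x u\<bar> \<le> real n" for u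
    using sum_abs[of "\<lambda>k. wal k x * wal k u" "{..<n}"] by (simp add: walsh_kernel_def)
  have "set_integrable lborel {0..1} (\<lambda>u. \<bar>walsh_kernel n x u\<bar>)"
    unfolding set_integrable_def
    by (rule integrableI_bounded_set_indicator[where B = "real n"]) (use meas bound in auto)
  then have "(LINT u:{0..1}|lborel. \<bar>walsh_kernel n x u\<bar>)
      = integral {0..1} (\<lambda>u. \<bar>walsh_kernel n x u\<bar>)"
    by (rule set_borel_integral_eq_integral)
  also have "\<dots> = lebesgue_rec n"
    using has_integral_abs_walsh_kernel by (rule integral_unique)
  finally show ?thesis
    by (simp add: walsh_lebesgue_function_def walsh_kernel_def)
qed


section \<open>The van der Corput sequence\<close>

lemma van_der_corput_cutoff:
  assumes "k \<le> N"
  shows "van_der_corput k = (\<Sum>j<N. real (nat_digit k j) / 2 ^ (j + 1))"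
  using sum_nat_digit_cutoff[of "\<lambda>j d. real d / 2 ^ (j + 1)", OF _ assms]
  by (simp add: van_der_corput_def)

lemma van_der_corput_0 [simp]: "van_der_corput 0 = 0"
  by (simp add: van_der_corput_def)

lemma van_der_corput_double: "van_der_corput (2 * k) = van_der_corput k / 2"
  using van_der_corput_cutoff[of "2 * k" "Suc (2 * k)"] van_der_corput_cutoff[of k "2 * k"]
  by (simp add: sum.lessThan_Suc_shift sum_divide_distrib mult_ac[where 'a = real] del: sum.lessThan_Suc)

lemma van_der_corput_double_Suc: "van_der_corput (Suc (2 * k)) = (1 + van_der_corput k) / 2"
  using van_der_corput_cutoff[of "Suc (2 * k)" "Suc (2 * k)"] van_der_corput_cutoff[of k "2 * k"]
  by (simp add: sum.lessThan_Suc_shift sum_divide_distrib add_divide_distrib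
      mult_ac[where 'a = real]
      del: sum.lessThan_Suc)

lemma van_der_corput_range: "0 \<le> van_der_corput k \<and> van_der_corput k < 1"
  by (induction k rule: nat_bit_induct)
    (simp_all add: van_der_corput_double van_der_corput_double_Suc)

section \<open>Signed local discrepancy, not normalized, as a sum over the points\<close>

definition vdc_excess :: "nat \<Rightarrow> real \<Rightarrow> real" where
  "vdc_excess n t = (\<Sum>k<n. of_bool (van_der_corput k < t) - t)"

lemma vdc_excess_0 [simp]: "vdc_excess 0 t = 0"
  and vdc_excess_Suc:
    "vdc_excess (Suc n) t = vdc_excess n t + of_bool (van_der_corput n < t) - t"
  by (simp_all add: vdc_excess_def)

lemma vdc_excess_eq_card:
  "vdc_excess n t = real (card {k. k < n \<and> van_der_corput k \<in> {0..<t}}) - real n * t"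
proof -
  have "{k. k < n \<and> van_der_corput k \<in> {0..<t}} = {..<n} \<inter> {k. van_der_corput k < t}"
    using van_der_corput_range by auto
  then show ?thesis
    by (simp add: vdc_excess_def sum_subtractf sum_of_bool_eq)
qed

text \<open>Points of even index fill the left half of the unit interval and those of odd index the
  right half, each as a scaled copy of the sequence.\<close>

lemma van_der_corput_less_halves:
  assumes "s \<in> {0..1}"
  shows "van_der_corput (2 * n) < s / 2 \<longleftrightarrow> van_der_corput n < s"
    and "\<not> van_der_corput (Suc (2 * n)) < s / 2"
    and "van_der_corput (2 * n) < (1 + s) / 2"
    and "van_der_corput (Suc (2 * n)) < (1 + s) / 2 \<longleftrightarrow> van_der_corput n < s"
  using assms van_der_corput_range[of n]
  unfolding van_der_corput_double van_der_corput_double_Suc by auto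

lemma vdc_excess_double:
  assumes "s \<in> {0..1}"
  shows "vdc_excess (2 * n) (s / 2) = vdc_excess n s"
    and "vdc_excess (2 * n) ((1 + s) / 2) = vdc_excess n s"
proof -
  have "vdc_excess (2 * n) (s / 2) = vdc_excess n s \<and>
      vdc_excess (2 * n) ((1 + s) / 2) = vdc_excess n s"
  proof (induction n)
    case (Suc n)
    have "vdc_excess (2 * Suc n) t = vdc_excess (2 * n) t + of_bool (van_der_corput (2 * n) < t)
        + of_bool (van_der_corput (Suc (2 * n)) < t) - 2 * t" for t
      by (simp add: vdc_excess_Suc)
    then show ?case
      by (simp only: van_der_corput_less_halves[OF assms] Suc.IH)
        (simp add: vdc_excess_Suc field_simps)
  qed simp
  then show "vdc_excess (2 * n) (s / 2) = vdc_excess n s"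
    "vdc_excess (2 * n) ((1 + s) / 2) = vdc_excess n s" by auto
qed

text \<open>The additional point, of index \<open>2 * n\<close>, lies in the left half. The two
  indicators are complementary, so exactly one of the two thresholds gains
  \<open>1/2\<close>.\<close>

lemma vdc_excess_double_Suc:
  assumes "s \<in> {0..1}"
  shows "vdc_excess (Suc (2 * n)) (s / 2) =
      (vdc_excess n s + vdc_excess (Suc n) s + of_bool (van_der_corput n < s)) / 2"
    and "vdc_excess (Suc (2 * n)) ((1 + s) / 2) =
      (vdc_excess n s + vdc_excess (Suc n) s + of_bool (s \<le> van_der_corput n)) / 2"
  by (simp_all only: vdc_excess_Suc vdc_excess_double[OF assms] van_der_corput_less_halves[OF assms])
    (auto simp: field_simps)

lemma unit_interval_halves:
  fixes P :: "real \<Rightarrow> bool"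
  assumes "\<And>s. s \<in> {0..1} \<Longrightarrow> P (s / 2)" "\<And>s. s \<in> {0..1} \<Longrightarrow> P ((1 + s) / 2)"
  shows "\<forall>t\<in>{0..1}. P t"
proof
  fix t :: real assume "t \<in> {0..1}"
  then show "P t"
    using assms(1)[of "2 * t"] assms(2)[of "2 * t - 1"] by (cases "t \<le> 1/2") auto
qed

text \<open>Both bounds pass through the recursion because its indicator lies between 0 and 1. The
  lower one removes the absolute value from the star discrepancy.\<close>

lemma vdc_excess_bounds:
  assumes "t \<in> {0..1}"
  shows "0 \<le> vdc_excess n t" "vdc_excess n t \<le> lebesgue_rec n"
proof -
  define B where "B n \<longleftrightarrow> (\<forall>t\<in>{0..1}. 0 \<le> vdc_excess n t \<and> vdc_excess n t \<le> lebesgue_rec n)" for n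
  have double: "B (2 * n)" if "B n" for n
    using that unfolding B_def
    by (intro unit_interval_halves) (simp_all add: vdc_excess_double)
  have double_Suc: "B (Suc (2 * n))" if "B n" "B (Suc n)" for n
    unfolding B_def
  proof (rule unit_interval_halves)
    fix s :: real assume s: "s \<in> {0..1}"
    have "0 \<le> vdc_excess n s" "vdc_excess n s \<le> lebesgue_rec n"
      "0 \<le> vdc_excess (Suc n) s" "vdc_excess (Suc n) s \<le> lebesgue_rec (Suc n)"
      using that s by (auto simp: B_def)
    then show "0 \<le> vdc_excess (Suc (2 * n)) (s / 2) \<and>
        vdc_excess (Suc (2 * n)) (s / 2) \<le> lebesgue_rec (Suc (2 * n))"
      "0 \<le> vdc_excess (Suc (2 * n)) ((1 + s) / 2) \<and>
        vdc_excess (Suc (2 * n)) ((1 + s) / 2) \<le> lebesgue_rec (Suc (2 * n))"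
      unfolding vdc_excess_double_Suc[OF s] lebesgue_rec_double_Suc by auto
  qed
  have "B n \<and> B (Suc n)"
  proof (induction n rule: nat_bit_induct)
    case zero
    show ?case by (auto simp: B_def vdc_excess_Suc)
  next
    case (even n)
    then show ?case using double double_Suc by blast
  next
    case (odd n)
    then show ?case using double[of "Suc n"] double_Suc[of n] by simp
  qed
  with assms show "0 \<le> vdc_excess n t" "vdc_excess n t \<le> lebesgue_rec n"
    by (auto simp: B_def)
qed

text \<open>The recursion averages the excesses of \<open>n\<close> and \<open>Suc n\<close> at the
  same \<open>s\<close>, hence the common \<open>t\<close>. The slack is genuine: for one point the
  excess is \<open>1 - t\<close> when \<open>t > 0\<close> but 0 at \<open>t = 0\<close>.\<close>

lemma vdc_excess_common_near_sup:
  assumes "0 < \<epsilon>"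
  shows "\<exists>t\<in>{0..1}. lebesgue_rec n - \<epsilon> \<le> vdc_excess n t \<and>
    lebesgue_rec (Suc n) - \<epsilon> \<le> vdc_excess (Suc n) t"
proof -
  \<comment> \<open>One \<open>t\<close> serves three consecutive indices, which contain the pairs
    starting at \<open>2 * n\<close> and at \<open>Suc (2 * n)\<close>.\<close>
  have step: "\<exists>t\<in>{0..1}. lebesgue_rec (2 * n) - \<epsilon> \<le> vdc_excess (2 * n) t \<and>
      lebesgue_rec (Suc (2 * n)) - \<epsilon> \<le> vdc_excess (Suc (2 * n)) t \<and>
      lebesgue_rec (2 * Suc n) - \<epsilon> \<le> vdc_excess (2 * Suc n) t"
    if IH: "\<exists>s\<in>{0..1}. lebesgue_rec n - \<epsilon> \<le> vdc_excess n s \<and>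
      lebesgue_rec (Suc n) - \<epsilon> \<le> vdc_excess (Suc n) s" for n
  proof -
    obtain s where s: "s \<in> {0..1}" "lebesgue_rec n - \<epsilon> \<le> vdc_excess n s"
      "lebesgue_rec (Suc n) - \<epsilon> \<le> vdc_excess (Suc n) s"
      using IH by blast
    \<comment> \<open>The half is chosen so that the indicator in
      \<open>vdc_excess_double_Suc\<close> equals 1.\<close>
    define t where "t = (if van_der_corput n < s then s / 2 else (1 + s) / 2)"
    have Suc_double: "vdc_excess (Suc (2 * n)) t = (vdc_excess n s + vdc_excess (Suc n) s + 1) / 2"
      by (simp add: t_def vdc_excess_double_Suc[OF s(1)])
    have double: "vdc_excess (2 * m) t = vdc_excess m s" for m
      by (simp add: t_def vdc_excess_double[OF s(1)])
    show ?thesis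
    proof (intro bexI conjI)
      show "lebesgue_rec (2 * n) - \<epsilon> \<le> vdc_excess (2 * n) t"
        "lebesgue_rec (Suc (2 * n)) - \<epsilon> \<le> vdc_excess (Suc (2 * n)) t"
        "lebesgue_rec (2 * Suc n) - \<epsilon> \<le> vdc_excess (2 * Suc n) t"
        unfolding lebesgue_rec_double lebesgue_rec_double_Suc Suc_double double
        using s(2,3) by (auto simp: field_simps)
      show "t \<in> {0..1}"
        using s(1) by (simp add: t_def)
    qed
  qed
  show ?thesis
  proof (induction n rule: nat_bit_induct)
    case zero
    show ?case
      \<comment> \<open>A positive \<open>t\<close> counts the point 0, and
        \<open>t \<le> \<epsilon>\<close> keeps the loss within the slack.\<close>
      using assms by (intro bexI[of _ "min \<epsilon> 1"]) (auto simp: vdc_excess_Suc)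
  next
    case (even n)
    with step[of n] show ?case by blast
  next
    case (odd n)
    with step[of n] show ?case by auto
  qed
qed

lemma star_discrepancy_van_der_corput:
  assumes "n \<ge> 1"
  shows "star_discrepancy van_der_corput n = lebesgue_rec n / real n"
proof -
  have eq: "\<bar>real (card {k. k < n \<and> van_der_corput k \<in> {0..<t}}) / real n - t\<bar>
      = vdc_excess n t / real n" if "t \<in> {0..1}" for t
  proof -
    have "real (card {k. k < n \<and> van_der_corput k \<in> {0..<t}}) / real n - t
        = vdc_excess n t / real n"
      using assms unfolding vdc_excess_eq_card by (simp add: field_simps)
    then show ?thesis
      using vdc_excess_bounds(1)[OF that, of n] by simp
  qed
  have "star_discrepancy van_der_corput n = (SUP t\<in>{0..1}. vdc_excess n t / real n)"
    unfolding star_discrepancy_def by (rule SUP_cong[OF refl eq])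
  also have "\<dots> = lebesgue_rec n / real n"
  proof (rule cSup_eq_non_empty)
    show "y \<le> lebesgue_rec n / real n" if "y \<in> (\<lambda>t. vdc_excess n t / real n) ` {0..1}" for y
      using that vdc_excess_bounds(2) by (auto intro: divide_right_mono)
    show "lebesgue_rec n / real n \<le> y"
      if ub: "\<And>z. z \<in> (\<lambda>t. vdc_excess n t / real n) ` {0..1} \<Longrightarrow> z \<le> y" for y
    proof -
      have "lebesgue_rec n \<le> y * real n + \<epsilon>" if "0 < \<epsilon>" for \<epsilon>
      proof -
        obtain t where t: "t \<in> {0..1}" "lebesgue_rec n - \<epsilon> \<le> vdc_excess n t"
          using vdc_excess_common_near_sup[OF \<open>0 < \<epsilon>\<close>] by blast
        have "vdc_excess n t / real n \<le> y"
          using t(1) by (intro ub imageI)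
        then show ?thesis
          using t(2) assms by (simp add: pos_divide_le_eq)
      qed
      then have "lebesgue_rec n \<le> y * real n"
        by (rule field_le_epsilon)
      then show ?thesis
        using assms by (simp add: pos_divide_le_eq)
    qed
  qed simp
  finally show ?thesis .
qed

theorem theorem2:
  fixes n :: nat
  assumes "n \<ge> 1"
  shows "(\<forall>x\<in>{0..<1}. walsh_lebesgue_function n x = real n * star_discrepancy van_der_corput n)
    \<and> walsh_lebesgue_constant n = real n * star_discrepancy van_der_corput n"
proof -
  have L: "real n * star_discrepancy van_der_corput n = lebesgue_rec n"
    using assms by (simp add: star_discrepancy_van_der_corput)
  have "walsh_lebesgue_constant n = lebesgue_rec n"
    unfolding walsh_lebesgue_constant_def walsh_lebesgue_function_eq
    \<comment> \<open>Uniqueness requires a point of \<open>{0..<1}\<close>; 0 serves.\<close>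
    by (rule the_equality) (auto intro: bexI[of _ "0::real"])
  with L show ?thesis
    by (simp add: walsh_lebesgue_function_eq)
qed

end
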